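(* Let $k,q$ be positive integers, let $N=2q+1$, and let $a,b>0$. Then $$ \begin{aligned} &\sum_{n=0}^{\infty}\frac{(-1)^n}{(n+b)^{4k(q+1)}}\sum_{i=0}^{\infty}\frac{(-1)^i(n+b)^{2k}}{(n+b)^{2k}+(i+a)^{2k}} +\sum_{n=0}^{\infty}\frac{(-1)^n}{(n+a)^{4k(q+1)}}\sum_{i=0}^{\infty}\frac{(-1)^i(n+a)^{2k}}{(n+a)^{2k}+(i+b)^{2k}}\\ &=\sum_{p=1}^{2q+1}(-1)^{p+1}\zeta_E(2kp,a)\,\zeta_E(2k(N-p+1),b). \end{aligned} $$
   Context: The alternating Hurwitz zeta function is $\zeta_E(z,x)=\sum_{n=0}^{\infty}\frac{(-1)^n}{(n+x)^z}$ for $\operatorname{Re}(z)>0$ and $x\neq0,-1,-2,\dots$. *)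

theory Defs
  imports Complex_Main "HOL-Analysis.Complex_Transcendental"
begin

text \<open>
  The power is the principal branch.  The definition is meaningful for \<open>Re z > 0\<close> and
  \<open>x \<noteq> 0, -1, -2, \<dots>\<close>; the series need only converge conditionally.
\<close>
definition zeta_E :: "complex \<Rightarrow> complex \<Rightarrow> complex" where
  "zeta_E z x = (\<Sum>n. (-1) ^ n / (of_nat n + x) powr z)"

end

theory Submission
  imports Defs "HOL-Analysis.Infinite_Sum" "HOL-Analysis.Summation_Tests"
begin

text \<open>
  With \<open>X = (n + b)\<^sup>2\<^sup>k\<close> and \<open>Y = (i + a)\<^sup>2\<^sup>k\<close> the two double series have the terms
  \<open>\<plusminus> 1 / (X\<^sup>N (X + Y))\<close> and \<open>\<plusminus> 1 / (Y\<^sup>N (X + Y))\<close>.  They converge absolutely as double series, so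
  they may be summed in the same order; since \<open>N\<close> is odd, \<open>X + Y\<close> divides \<open>X\<^sup>N + Y\<^sup>N\<close>, and
  the combined term splits into a finite sum of products of powers of \<open>1 / X\<close> and \<open>1 / Y\<close>.
\<close>

text \<open>The product bound makes the family absolutely summable over all index pairs, so the
  iterated sum agrees with the unordered one. The \<open>has_sum\<close> form is what later permits
  exchanging the two indices.\<close>

lemma double_series_has_sum:
  fixes f :: "nat \<Rightarrow> nat \<Rightarrow> real"
  assumes u: "summable u" "\<And>n. u n \<ge> 0" and v: "summable v" "\<And>i. v i \<ge> 0"
    and le: "\<And>n i. \<bar>f n i\<bar> \<le> u n * v i"
  shows "((\<lambda>(n, i). f n i) has_sum (\<Sum>n. \<Sum>i. f n i)) (UNIV \<times> UNIV)"
proof -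
  have hu: "(u has_sum suminf u) UNIV" and hv: "(v has_sum suminf v) UNIV"
    using u v by (auto intro!: norm_summable_imp_has_sum)
  have "(\<lambda>(n, i). u n * v i) summable_on (UNIV \<times> UNIV)"
  proof (rule summable_on_SigmaI[where g = "\<lambda>n. u n * suminf v"])
    show "((\<lambda>i. case (n, i) of (n, i) \<Rightarrow> u n * v i) has_sum u n * suminf v) UNIV" for n
      using has_sum_cmult_right[OF hv, of "u n"] by simp
    show "(\<lambda>n. u n * suminf v) summable_on UNIV"
      using has_sum_cmult_left[OF hu, of "suminf v"] has_sum_imp_summable by blast
  qed (use u v in auto)
  then have "(\<lambda>p. norm (case p of (n, i) \<Rightarrow> f n i)) summable_on (UNIV \<times> UNIV)"
    by (rule abs_summable_on_comparison_test') (use le in auto)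
  then have "(\<lambda>(n, i). f n i) summable_on (UNIV \<times> UNIV)"
    by (rule abs_summable_summable)
  then obtain S where S: "((\<lambda>(n, i). f n i) has_sum S) (UNIV \<times> UNIV)"
    by (auto simp: summable_on_def)
  \<comment> \<open>Each row is dominated by \<open>u n * v i\<close> with \<open>n\<close> fixed;
    knowing all row sums identifies the unordered total \<open>S\<close> with the iterated
    series.\<close>
  have "((\<lambda>i. f n i) has_sum (\<Sum>i. f n i)) UNIV" for n
  proof (rule norm_summable_imp_has_sum)
    have "summable (\<lambda>i. u n * v i)"
      using v by (intro summable_mult)
    then show *: "summable (\<lambda>i. norm (f n i))"
      by (rule summable_comparison_test') (use le in auto)
    show "(\<lambda>i. f n i) sums (\<Sum>i. f n i)"
      using summable_norm_cancel[OF *] by (rule summable_sums)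
  qed
  then have "((\<lambda>n. \<Sum>i. f n i) has_sum S) UNIV"
    by (intro has_sum_SigmaD[OF S]) auto
  then have "(\<Sum>n. \<Sum>i. f n i) = S"
    using has_sum_imp_sums sums_iff by blast
  with S show ?thesis by simp
qed

lemma has_sum_sum:
  fixes f :: "'i \<Rightarrow> 'a \<Rightarrow> 'b::topological_comm_monoid_add"
  assumes "\<And>i. i \<in> I \<Longrightarrow> (f i has_sum S i) A"
  shows "((\<lambda>x. \<Sum>i\<in>I. f i x) has_sum (\<Sum>i\<in>I. S i)) A"
  using assms by (induction I rule: infinite_finite_induct) (auto intro: has_sum_add)

lemma product_series_has_sum:
  fixes u v :: "nat \<Rightarrow> real"
  assumes u: "summable (\<lambda>n. \<bar>u n\<bar>)" and v: "summable (\<lambda>n. \<bar>v n\<bar>)"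
  shows "((\<lambda>(n, i). u n * v i) has_sum (suminf u * suminf v)) (UNIV \<times> UNIV)"
proof -
  have su: "summable u" and sv: "summable v"
    using u v by (auto intro: summable_rabs_cancel)
  have "((\<lambda>(n, i). u n * v i) has_sum (\<Sum>n. \<Sum>i. u n * v i)) (UNIV \<times> UNIV)"
    by (rule double_series_has_sum[OF u _ v]) (auto simp: abs_mult)
  then show ?thesis
    using su sv by (simp add: suminf_mult suminf_mult2[symmetric])
qed

text \<open>Early terms \<open>1 / x n\<close> may exceed 1, but they tend to 0, and once below 1
  they only shrink when raised to a positive power.\<close>

lemma summable_inverse_power:
  fixes x :: "nat \<Rightarrow> real"
  assumes pos: "\<And>n. x n > 0" and sm: "summable (\<lambda>n. 1 / x n)" and p: "p > 0"
  shows "summable (\<lambda>n. 1 / x n ^ p)"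
proof (rule summable_comparison_test_ev[OF _ sm])
  have "(\<lambda>n. 1 / x n) \<longlonglongrightarrow> 0"
    using sm by (rule summable_LIMSEQ_zero)
  then have "\<forall>\<^sub>F n in sequentially. 1 / x n < 1"
    by (rule order_tendstoD) simp
  then show "\<forall>\<^sub>F n in sequentially. norm (1 / x n ^ p) \<le> 1 / x n"
  proof eventually_elim
    case (elim n)
    then have "(1 / x n) ^ p \<le> (1 / x n) ^ 1"
      using pos[of n] p by (intro power_decreasing) auto
    then show ?case using pos[of n] by (simp add: power_divide)
  qed
qed

text \<open>For odd \<open>N\<close> the numerator \<open>x ^ N + y ^ N\<close> is the difference of
  the \<open>N\<close>-th powers of \<open>x\<close> and \<open>- y\<close>, so the factor
  \<open>x + y\<close> cancels and a finite geometric-type sum remains.\<close>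

lemma odd_partial_fractions:
  fixes x y :: real
  assumes pos: "x > 0" "y > 0" and odd: "odd N"
  shows "1 / (x ^ N * (x + y)) + 1 / (y ^ N * (x + y)) =
    (\<Sum>p = 1..N. (-1) ^ (p + 1) * (1 / x ^ (N - p + 1) * (1 / y ^ p)))"
proof -
  obtain M where M: "N = Suc M" "even M"
    using odd by (metis even_Suc oddE Suc_eq_plus1 dvd_triv_left)
  have "x ^ N + y ^ N = (x + y) * (\<Sum>p<N. x ^ p * (- y) ^ (M - p))"
    using diff_power_eq_sum[of x M "- y"] M by simp
  then have "1 / (x ^ N * (x + y)) + 1 / (y ^ N * (x + y)) =
      (\<Sum>p<N. x ^ p * (- y) ^ (M - p)) / (x ^ N * y ^ N)"
    using pos by (simp add: divide_simps) (simp add: algebra_simps)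
  also have "\<dots> = (\<Sum>p<N. x ^ p * (- y) ^ (M - p) / (x ^ N * y ^ N))"
    by (simp add: sum_divide_distrib)
  also have "\<dots> = (\<Sum>p = 1..N. (-1) ^ (p + 1) * (1 / x ^ (N - p + 1) * (1 / y ^ p)))"
  proof (rule sum.reindex_bij_witness[where i = "\<lambda>p. p - 1" and j = Suc])
    fix p assume "p \<in> {..<N}"
    then obtain r where r: "M = p + r" using M by (auto simp: less_Suc_eq_le le_iff_add)
    \<comment> \<open>As \<open>M\<close> is even, \<open>p\<close> and \<open>M - p\<close> have
      the same parity; this gives the sign \<open>(-1) ^ p\<close>, equal to
      \<open>(-1) ^ (Suc p + 1)\<close> after the index shift.\<close>
    then have "even p = even r" using M by simp
    then have "(- y) ^ r = (-1) ^ p * y ^ r" by (simp add: power_minus[of y] uminus_power_if)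
    then show "(-1) ^ (Suc p + 1) * (1 / x ^ (N - Suc p + 1) * (1 / y ^ Suc p)) =
        x ^ p * (- y) ^ (M - p) / (x ^ N * y ^ N)"
      using pos M r by (simp add: divide_simps power_add)
  qed auto
  finally show ?thesis .
qed

text \<open>Transposing the second double series puts both on the same pairs \<open>(n, i)\<close>.
  Partial fractions then give, for each \<open>p\<close>, a product of two absolutely convergent
  series, and uniqueness of the unordered sum yields the identity.\<close>

lemma sum_of_swapped_double_series:
  fixes x y e :: "nat \<Rightarrow> real"
  assumes x: "\<And>n. x n > 0" "summable (\<lambda>n. 1 / x n)"
    and y: "\<And>n. y n > 0" "summable (\<lambda>n. 1 / y n)"
    and e: "\<And>n. \<bar>e n\<bar> \<le> 1" and odd: "odd N"
  shows "(\<Sum>n. \<Sum>i. e n * e i / (x n ^ N * (x n + y i))) +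
      (\<Sum>n. \<Sum>i. e n * e i / (y n ^ N * (y n + x i))) =
    (\<Sum>p = 1..N. (-1) ^ (p + 1) * (\<Sum>i. e i / y i ^ p) * (\<Sum>n. e n / x n ^ (N - p + 1)))"
proof -
  have N: "N > 0" using odd by (cases N) auto
  have ee: "\<bar>e n\<bar> * \<bar>e i\<bar> \<le> 1" for n i
    using mult_mono[OF e[of n] e[of i]] by simp
  \<comment> \<open>Stated for arbitrary \<open>x\<close> and \<open>y\<close> so that it also
    applies with the two exchanged. Bounding \<open>x n + y i\<close> below by \<open>y i\<close>
    makes the majorant a product.\<close>
  have one: "((\<lambda>(n, i). e n * e i / (x n ^ N * (x n + y i))) has_sum
      (\<Sum>n. \<Sum>i. e n * e i / (x n ^ N * (x n + y i)))) (UNIV \<times> UNIV)"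
    if x: "\<And>n. x n > 0" "summable (\<lambda>n. 1 / x n)"
      and y: "\<And>n. y n > 0" "summable (\<lambda>n. 1 / y n)" for x y :: "nat \<Rightarrow> real"
  proof (rule double_series_has_sum[OF summable_inverse_power[OF x N] _ y(2)])
    show "\<bar>e n * e i / (x n ^ N * (x n + y i))\<bar> \<le> 1 / x n ^ N * (1 / y i)" for n i
    proof -
      have "\<bar>e n * e i / (x n ^ N * (x n + y i))\<bar> =
          (\<bar>e n\<bar> * \<bar>e i\<bar>) / (x n ^ N * (x n + y i))"
        using x(1)[of n] y(1)[of i] by (simp add: abs_mult)
      also have "\<dots> \<le> 1 / (x n ^ N * y i)"
        using x(1)[of n] y(1)[of i] ee[of n i] by (intro frac_le mult_left_mono) auto
      finally show ?thesis by simp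
    qed
  qed (use x(1) y(1) in \<open>auto intro: less_imp_le\<close>)
  have "((\<lambda>(n, i). e n * e i / (x n ^ N * (x n + y i)) + e i * e n / (y i ^ N * (y i + x n)))
    has_sum ((\<Sum>n. \<Sum>i. e n * e i / (x n ^ N * (x n + y i))) +
      (\<Sum>n. \<Sum>i. e n * e i / (y n ^ N * (y n + x i))))) (UNIV \<times> UNIV)"
    using has_sum_add[OF one[OF x y] one[OF y x, THEN has_sum_swap[THEN iffD1]]]
    by (simp add: case_prod_unfold)
  moreover have "(\<lambda>(n, i). e n * e i / (x n ^ N * (x n + y i)) + e i * e n / (y i ^ N * (y i + x n)))
     = (\<lambda>q. \<Sum>p = 1..N. (-1) ^ (p + 1) *
         (case q of (n, i) \<Rightarrow> e n / x n ^ (N - p + 1) * (e i / y i ^ p)))"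
  proof -
    have "e n * e i / (x n ^ N * (x n + y i)) + e i * e n / (y i ^ N * (y i + x n)) =
        (\<Sum>p = 1..N. (-1) ^ (p + 1) * (e n / x n ^ (N - p + 1) * (e i / y i ^ p)))" for n i
    proof -
      have "e n * e i / (x n ^ N * (x n + y i)) + e i * e n / (y i ^ N * (y i + x n)) =
          e n * e i * (1 / (x n ^ N * (x n + y i)) + 1 / (y i ^ N * (x n + y i)))"
        by (simp add: ring_distribs add.commute[of "y i"] mult.commute[of "e i"])
      then show ?thesis
        unfolding odd_partial_fractions[OF x(1) y(1) odd] by (simp add: sum_distrib_left mult_ac)
    qed
    then show ?thesis by (intro ext) (simp only: case_prod_unfold)
  qed
  moreover have "((\<lambda>q. \<Sum>p = 1..N. (-1) ^ (p + 1) *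
         (case q of (n, i) \<Rightarrow> e n / x n ^ (N - p + 1) * (e i / y i ^ p))) has_sum
      (\<Sum>p = 1..N. (-1) ^ (p + 1) *
         ((\<Sum>n. e n / x n ^ (N - p + 1)) * (\<Sum>i. e i / y i ^ p)))) (UNIV \<times> UNIV)"
  \<comment> \<open>Both exponents \<open>N - p + 1\<close> and \<open>p\<close> are positive on the
    summation range, so every factor converges absolutely.\<close>
  proof (intro has_sum_sum has_sum_cmult_right product_series_has_sum)
    have abs: "summable (\<lambda>n. \<bar>e n / z n ^ p\<bar>)"
      if "\<And>n. z n > 0" "summable (\<lambda>n. 1 / z n)" "p > 0" for z :: "nat \<Rightarrow> real" and p
      by (rule summable_comparison_test'[OF summable_inverse_power[OF that]])
        (use that e in \<open>auto simp: abs_mult divide_simps less_imp_le\<close>)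
    show "summable (\<lambda>n. \<bar>e n / x n ^ (N - p + 1)\<bar>)" for p
      by (rule abs[OF x]) simp
    show "summable (\<lambda>n. \<bar>e n / y n ^ p\<bar>)" if "p \<in> {1..N}" for p
      by (rule abs[OF y]) (use that in simp)
  qed
  ultimately show ?thesis
    by (simp add: has_sum_unique mult_ac)
qed

lemma summable_inverse_shift_power:
  fixes c :: real
  assumes "c > 0" "m \<ge> 2"
  shows "summable (\<lambda>n. 1 / (real n + c) ^ m)"
proof (rule summable_comparison_test_ev[OF _ inverse_power_summable[OF \<open>m \<ge> 2\<close>]])
  show "\<forall>\<^sub>F n in sequentially. norm (1 / (real n + c) ^ m) \<le> inverse (of_nat n ^ m)"
    \<comment> \<open>At \<open>n = 0\<close> the majorant is 0 because
      \<open>inverse 0 = 0\<close>, so the comparison holds only from \<open>n = 1\<close>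
      on.\<close>
    using eventually_gt_at_top[of 0]
    by eventually_elim (use assms in \<open>auto simp: inverse_eq_divide intro!: frac_le power_mono\<close>)
qed

text \<open>A principal power with positive natural exponent is an ordinary power, and
  \<open>m \<ge> 2\<close> gives absolute convergence, so the real series can be embedded
  termwise.\<close>

lemma zeta_E_of_real:
  fixes c :: real
  assumes "c > 0" "m \<ge> 2"
  shows "zeta_E (of_nat m) (of_real c) = of_real (\<Sum>n. (-1) ^ n / (real n + c) ^ m)"
proof -
  have "summable (\<lambda>n. (-1) ^ n / (real n + c) ^ m)"
    by (rule summable_comparison_test'[OF summable_inverse_shift_power[OF assms]])
      (use assms in \<open>auto simp: abs_mult power_abs\<close>)
  then have "of_real (\<Sum>n. (-1) ^ n / (real n + c) ^ m) =
      (\<Sum>n. complex_of_real ((-1) ^ n / (real n + c) ^ m))"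
    by (rule suminf_of_real)
  also have "(\<lambda>n. complex_of_real ((-1) ^ n / (real n + c) ^ m)) =
      (\<lambda>n. (-1) ^ n / (of_nat n + of_real c) powr of_nat m)"
    using assms by (intro ext) (simp add: powr_nat')
  finally show ?thesis by (simp add: zeta_E_def)
qed

theorem corollary1p24:
  fixes k q N :: nat and a b :: real
  assumes "k > 0" and "q > 0" and "N = 2 * q + 1" and "a > 0" and "b > 0"
  shows
    "complex_of_real
      ((\<Sum>n. (-1) ^ n / (real n + b) ^ (4 * k * (q + 1)) *
          (\<Sum>i. (-1) ^ i * (real n + b) ^ (2 * k) /
                ((real n + b) ^ (2 * k) + (real i + a) ^ (2 * k)))) +
       (\<Sum>n. (-1) ^ n / (real n + a) ^ (4 * k * (q + 1)) *
          (\<Sum>i. (-1) ^ i * (real n + a) ^ (2 * k) /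
                ((real n + a) ^ (2 * k) + (real i + b) ^ (2 * k))))) =
     (\<Sum>p = 1..2 * q + 1. (-1) ^ (p + 1) *
        zeta_E (of_nat (2 * k * p)) (of_real a) *
        zeta_E (of_nat (2 * k * (N - p + 1))) (of_real b))"
proof -
  define x where "x n = (real n + b) ^ (2 * k)" for n
  define y where "y n = (real n + a) ^ (2 * k)" for n
  define e :: "nat \<Rightarrow> real" where "e n = (-1) ^ n" for n
  have x: "x n > 0" "summable (\<lambda>n. 1 / x n)" and y: "y n > 0" "summable (\<lambda>n. 1 / y n)" for n
    using assms by (auto simp: x_def y_def intro!: summable_inverse_shift_power zero_less_power)
  have e: "\<bar>e n\<bar> = 1" for n by (simp add: e_def power_abs)
  \<comment> \<open>Moving the prefactor into the inner series, which converges by comparison with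
    \<open>u n / v i\<close>, cancels one power of \<open>u n\<close>.\<close>
  have inner: "(\<Sum>n. e n / u n ^ (N + 1) * (\<Sum>i. e i * u n / (u n + v i))) =
      (\<Sum>n. \<Sum>i. e n * e i / (u n ^ N * (u n + v i)))"
    if u: "\<And>n. u n > 0" and v: "\<And>n. v n > 0" "summable (\<lambda>n. 1 / v n)" for u v :: "nat \<Rightarrow> real"
  proof (intro suminf_cong)
    fix n
    have "summable (\<lambda>i. u n * (1 / v i))"
      using v(2) by (rule summable_mult)
    then have "summable (\<lambda>i. e i * u n / (u n + v i))"
    proof (rule summable_comparison_test')
      show "norm (e i * u n / (u n + v i)) \<le> u n * (1 / v i)" for i
        using u[of n] v(1)[of i] e[of i] by (simp add: abs_mult frac_le)
    qed
    then have "e n / u n ^ (N + 1) * (\<Sum>i. e i * u n / (u n + v i)) =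
        (\<Sum>i. e n / u n ^ (N + 1) * (e i * u n / (u n + v i)))"
      by (rule suminf_mult[symmetric])
    also have "\<dots> = (\<Sum>i. e n * e i / (u n ^ N * (u n + v i)))"
      using u[of n] by (intro suminf_cong) simp
    finally show "e n / u n ^ (N + 1) * (\<Sum>i. e i * u n / (u n + v i)) =
        (\<Sum>i. e n * e i / (u n ^ N * (u n + v i)))" .
  qed
  \<comment> \<open>Since \<open>N + 1 = 2 * (q + 1)\<close>, the outer denominators are
    \<open>x n ^ (N + 1)\<close> and \<open>y n ^ (N + 1)\<close>.\<close>
  have exponent: "4 * k * (q + 1) = 2 * k * (N + 1)"
    using assms by simp
  \<comment> \<open>Positivity of \<open>k\<close> and \<open>p\<close> makes the exponent
    \<open>2 * k * p\<close> at least 2, as \<open>zeta_E_of_real\<close> requires.\<close>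
  have zeta: "zeta_E (of_nat (2 * k * p)) (of_real c) =
      of_real (\<Sum>n. e n / ((real n + c) ^ (2 * k)) ^ p)" if "p > 0" "c > 0" for p c
    unfolding e_def power_mult[symmetric]
    by (rule zeta_E_of_real) (use that assms in \<open>auto simp: Suc_le_eq\<close>)
  have "odd N" using assms by simp
  have "(\<Sum>n. e n / x n ^ (N + 1) * (\<Sum>i. e i * x n / (x n + y i))) +
      (\<Sum>n. e n / y n ^ (N + 1) * (\<Sum>i. e i * y n / (y n + x i))) =
    (\<Sum>p = 1..N. (-1) ^ (p + 1) * (\<Sum>i. e i / y i ^ p) * (\<Sum>n. e n / x n ^ (N - p + 1)))"
    unfolding inner[OF x(1) y] inner[OF y(1) x]
    by (rule sum_of_swapped_double_series[OF x y _ \<open>odd N\<close>]) (simp add: e)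
  then have "complex_of_real ((\<Sum>n. e n / x n ^ (N + 1) * (\<Sum>i. e i * x n / (x n + y i))) +
      (\<Sum>n. e n / y n ^ (N + 1) * (\<Sum>i. e i * y n / (y n + x i)))) =
    (\<Sum>p = 1..N. (-1) ^ (p + 1) * of_real (\<Sum>i. e i / y i ^ p) *
      of_real (\<Sum>n. e n / x n ^ (N - p + 1)))"
    by simp
  also have "\<dots> = (\<Sum>p = 1..N. (-1) ^ (p + 1) * zeta_E (of_nat (2 * k * p)) (of_real a) *
      zeta_E (of_nat (2 * k * (N - p + 1))) (of_real b))"
    unfolding x_def y_def
    by (intro sum.cong refl arg_cong2[of _ _ _ _ "(*)"] zeta[symmetric]) (use assms in auto)
  finally show ?thesis
    \<comment> \<open>The instance of \<open>power_mult\<close> is fixed so that only the outer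
      exponent is split.\<close>
    unfolding exponent power_mult[of _ "2 * k" "N + 1"]
    unfolding x_def y_def e_def assms(3) .
qed

end
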